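(* Consider a single TTL cache and one object with periodic requests, i.e. deterministic inter-request time $x>0$, i.i.d. exponentially distributed TTLs with parameter $\lambda_T>0$ and i.i.d. exponentially distributed object fetch delays with parameter $\lambda_\Delta>0$. Let $\bar\tau_\Delta=\frac{1}{\lambda_\Delta x}$ and $\bar\tau_T=\frac{1}{\lambda_T x}$ be the ratios of expected delay and expected TTL to the inter-request time, and define $$\bar\tau_\Delta^+=\begin{cases}-1/W_{-1}\!\left(-\frac{1}{\bar\tau_T}e^{-1/\bar\tau_T}\right), & \bar\tau_T\ge 1,\\[4pt] -1/W_{0}\!\left(-\frac{1}{\bar\tau_T}e^{-1/\bar\tau_T}\right), & \bar\tau_T<1,\end{cases}$$ where $W_a$ denotes the $a$-th real branch of the Lambert $W$ function. If $\bar\tau_\Delta\le\bar\tau_\Delta^+$, then the object hit probability of the cache under the delay is larger than or equal to its object hit probability at zero delay.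
   Context: Cache dynamics: requests arrive at times $0,x,2x,\dots$. A request that finds the object neither in cache nor being fetched is a miss and starts a fetch of random duration $\Delta$; requests arriving during the fetch also count as misses (and do not start a new fetch). When the fetch ends, the object is admitted to the cache and a fresh TTL $T$ starts. A request arriving while the object is in cache is a hit, and the TTL is regenerative: each hit replaces the current TTL by a fresh one. The object leaves the cache when its current TTL expires. All TTLs and delays are mutually independent. A cycle is the period between two consecutive fetch-initiating misses. The object hit probability is the long-run fraction of requests that are hits, i.e. $P_h=\mathbb E[N]/(1+\mathbb E[m]+\mathbb E[N])$ where, per cycle, $N$ is the number of hits and $m$ is the number of requests arriving during the fetch delay (not counting the request initiating the fetch). At zero delay (the object is admitted and its TTL started at the instant of the miss) $P_h=\mathbb P(x<T)$. $W_0$ and $W_{-1}$ are the two real solutions $w$ of $we^w=h$ for $-1/e\le h<0$, with $W_0(h)\ge -1$ and $W_{-1}(h)\le -1$. *)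

theory Defs
  imports "HOL-Probability.Probability"
begin

datatype request_kind = Fetch_Miss | Delayed_Miss | Hit

text \<open>
  A cache state is a pair of times \<open>(f, e)\<close>: the most recent fetch ends at \<open>f\<close>, and the
  current TTL (which starts at \<open>f\<close> and is renewed by hits) expires at \<open>e\<close>. Hence the object is
  being fetched until \<open>f\<close>, is in the cache during \<open>{f..<e}\<close>, and is absent from \<open>e\<close> on.
\<close>

fun request_kind_at :: "real \<Rightarrow> real \<times> real \<Rightarrow> request_kind" where
  "request_kind_at t (f, e) =
     (if t < f then Delayed_Miss else if t < e then Hit else Fetch_Miss)"

text \<open>
  \<open>cache_state x D T k\<close> is the state seen by request \<open>k\<close>, which arrives at time \<open>k x\<close>.
  Delays and TTLs are indexed by the request that triggers them: if request \<open>k\<close> initiates a fetch,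
  the fetch lasts \<open>D k\<close> and the TTL started at its end is \<open>T k\<close>; if request \<open>k\<close> is a hit, it
  replaces the current TTL by \<open>T k\<close>; otherwise \<open>D k\<close> and \<open>T k\<close> are not used. In the initial
  state \<open>(0, 0)\<close> the object is absent, so request \<open>0\<close> initiates a fetch.
\<close>

primrec cache_state :: "real \<Rightarrow> (nat \<Rightarrow> real) \<Rightarrow> (nat \<Rightarrow> real) \<Rightarrow> nat \<Rightarrow> real \<times> real" where
  "cache_state x D T 0 = (0, 0)"
| "cache_state x D T (Suc k) =
     (let t = real k * x; s = cache_state x D T k
      in case request_kind_at t s of
           Fetch_Miss \<Rightarrow> (t + D k, t + D k + T k)
         | Delayed_Miss \<Rightarrow> s
         | Hit \<Rightarrow> (fst s, t + T k))"

definition request_kind :: "real \<Rightarrow> (nat \<Rightarrow> real) \<Rightarrow> (nat \<Rightarrow> real) \<Rightarrow> nat \<Rightarrow> request_kind" where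
  "request_kind x D T k = request_kind_at (real k * x) (cache_state x D T k)"

text \<open>The cycle that starts with the fetch-initiating request \<open>0\<close>.\<close>

definition cycle :: "real \<Rightarrow> (nat \<Rightarrow> real) \<Rightarrow> (nat \<Rightarrow> real) \<Rightarrow> nat set" where
  "cycle x D T = {k. \<forall>j\<in>{1..k}. request_kind x D T j \<noteq> Fetch_Miss}"

text \<open>
  The counts take values in \<open>[0, \<infinity>]\<close> so that they are also meaningful on the null set where the
  cycle never ends.
\<close>

definition cycle_hits :: "real \<Rightarrow> (nat \<Rightarrow> real) \<Rightarrow> (nat \<Rightarrow> real) \<Rightarrow> ennreal" where
  "cycle_hits x D T =
     emeasure (count_space UNIV) {k \<in> cycle x D T. request_kind x D T k = Hit}"

definition cycle_delayed_misses :: "real \<Rightarrow> (nat \<Rightarrow> real) \<Rightarrow> (nat \<Rightarrow> real) \<Rightarrow> ennreal" where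
  "cycle_delayed_misses x D T =
     emeasure (count_space UNIV) {k \<in> cycle x D T. request_kind x D T k = Delayed_Miss}"

text \<open>
  \<open>E[N] / (1 + E[m] + E[N])\<close>, where \<open>N\<close> and \<open>m\<close> are the numbers of hits and of delayed misses
  in a cycle. Zero delay is the case \<open>D = (\<lambda>_ _. 0)\<close>.
\<close>

definition hit_probability ::
  "'a measure \<Rightarrow> real \<Rightarrow> (nat \<Rightarrow> 'a \<Rightarrow> real) \<Rightarrow> (nat \<Rightarrow> 'a \<Rightarrow> real) \<Rightarrow> ennreal" where
  "hit_probability M x D T =
     (let EN = (\<integral>\<^sup>+ \<omega>. cycle_hits x (\<lambda>k. D k \<omega>) (\<lambda>k. T k \<omega>) \<partial>M);
          Em = (\<integral>\<^sup>+ \<omega>. cycle_delayed_misses x (\<lambda>k. D k \<omega>) (\<lambda>k. T k \<omega>) \<partial>M)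
      in EN / (1 + Em + EN))"

text \<open>The real branches of the Lambert W function, meaningful for \<open>- 1 / exp 1 \<le> h < 0\<close>.\<close>

definition Lambert_W0 :: "real \<Rightarrow> real" where
  "Lambert_W0 h = (THE w. w * exp w = h \<and> w \<ge> -1)"

definition Lambert_Wm1 :: "real \<Rightarrow> real" where
  "Lambert_Wm1 h = (THE w. w * exp w = h \<and> w \<le> -1)"

definition tau_plus :: "real \<Rightarrow> real" where
  "tau_plus \<tau> =
     (if \<tau> \<ge> 1 then - 1 / Lambert_Wm1 (- (1 / \<tau>) * exp (- (1 / \<tau>)))
      else - 1 / Lambert_W0 (- (1 / \<tau>) * exp (- (1 / \<tau>))))"

end

theory Submission
  imports Defs "HOL-Real_Asymp.Real_Asymp"
begin

text \<open>
  Write \<open>q = exp (- lambda_T x)\<close> and \<open>p = exp (- lambda_D x)\<close>. In a cycle, the fetch ends in the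
  \<open>n\<close>-th inter-request interval and the next request is a hit with probability \<open>p ^ n w\<close> for a
  weight \<open>w\<close> that does not depend on \<open>n\<close>; each hit is then followed by another one with
  probability \<open>q\<close>. Hence \<open>E[N] = w / ((1 - p) (1 - q))\<close> and \<open>1 + E[m] = 1 / (1 - p)\<close>, so the hit
  probability is \<open>w / (1 - q + w)\<close>, which is at least the zero-delay value \<open>q\<close> iff \<open>w \<ge> q\<close>.
  With \<open>u = lambda_D x\<close> and \<open>v = lambda_T x\<close> this compares \<open>u exp (- u)\<close> with \<open>v exp (- v)\<close>, in a
  direction that depends on the sign of \<open>u - v\<close>. Since \<open>1 / tau_plus (1 / v)\<close> is the root of
  \<open>y exp (- y) = v exp (- v)\<close> on the other side of the maximum at \<open>1\<close>, the claim follows from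
  unimodality.
\<close>

subsection \<open>The Lambert W branches and the threshold\<close>

text \<open>The derivative \<open>(1 + w) * exp w\<close> changes sign only at \<open>-1\<close>.
  This lemma and the next give uniqueness on each Lambert branch and, together, the global minimum
  at \<open>-1\<close>.\<close>

lemma w_exp_strict_mono:
  fixes a b :: real
  assumes "-1 \<le> a" "a < b"
  shows "a * exp a < b * exp b"
proof (rule DERIV_pos_imp_increasing_open[OF assms(2)])
  fix w assume "a < w" "w < b"
  then show "\<exists>y. DERIV (\<lambda>w. w * exp w) w :> y \<and> y > 0"
    using assms
    by (intro exI[of _ "(1 + w) * exp w"] conjI mult_pos_pos)
      (auto intro!: derivative_eq_intros simp: algebra_simps)
qed (intro continuous_intros)

lemma w_exp_strict_antimono:
  fixes a b :: real
  assumes "b \<le> -1" "a < b"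
  shows "b * exp b < a * exp a"
proof (rule DERIV_neg_imp_decreasing_open[OF assms(2)])
  fix w assume "a < w" "w < b"
  then show "\<exists>y. DERIV (\<lambda>w. w * exp w) w :> y \<and> y < 0"
    using assms
    by (intro exI[of _ "(1 + w) * exp w"] conjI mult_neg_pos)
      (auto intro!: derivative_eq_intros simp: algebra_simps)
qed (intro continuous_intros)

lemma w_exp_ge: "- exp (-1) \<le> w * exp (w :: real)"
  using w_exp_strict_mono[of "-1" w] w_exp_strict_antimono[of "-1" w]
  by (cases w "-1 :: real" rule: linorder_cases) auto

lemma Lambert_W0_works:
  assumes "- exp (-1) \<le> h" "h < 0"
  shows "Lambert_W0 h * exp (Lambert_W0 h) = h \<and> Lambert_W0 h \<ge> -1"
proof -
  have "\<exists>w. -1 \<le> w \<and> w \<le> 0 \<and> w * exp w = h"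
    by (rule IVT') (use assms in \<open>auto intro!: continuous_intros\<close>)
  then have "\<exists>!w. w * exp w = h \<and> w \<ge> -1"
    by (metis linorder_neqE w_exp_strict_mono less_irrefl)
  then show ?thesis
    unfolding Lambert_W0_def by (rule theI')
qed

lemma Lambert_Wm1_works:
  assumes "- exp (-1) \<le> h" "h < 0"
  shows "Lambert_Wm1 h * exp (Lambert_Wm1 h) = h \<and> Lambert_Wm1 h \<le> -1"
proof -
  \<comment> \<open>The intermediate value theorem needs a left endpoint with value above
    \<open>h\<close>; it exists because the function tends to \<open>0\<close>, which exceeds
    \<open>h\<close>, at minus infinity.\<close>
  have "((\<lambda>w::real. w * exp w) \<longlongrightarrow> 0) at_bot"
    by real_asymp
  then have "\<forall>\<^sub>F w::real in at_bot. h < w * exp w"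
    using assms(2) by (rule order_tendstoD)
  then have "\<forall>\<^sub>F w::real in at_bot. h < w * exp w \<and> w \<le> -1"
    using eventually_le_at_bot eventually_conj by blast
  then obtain a :: real where a: "h < a * exp a" "a \<le> -1"
    using eventually_happens'[of "at_bot :: real filter"] by auto
  have "\<exists>w. a \<le> w \<and> w \<le> -1 \<and> w * exp w = h"
    by (rule IVT2') (use assms a in \<open>auto intro!: continuous_intros\<close>)
  then have "\<exists>!w. w * exp w = h \<and> w \<le> -1"
    by (metis linorder_neqE w_exp_strict_antimono less_irrefl)
  then show ?thesis
    unfolding Lambert_Wm1_def by (rule theI')
qed

text \<open>\<open>- v\<close> already solves \<open>w * exp w = - v * exp (- v)\<close>, and
  \<open>tau_plus\<close> picks the branch on the other side of \<open>-1\<close>. So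
  \<open>y\<close> is the partner of \<open>v\<close> across the maximum of
  \<open>y * exp (- y)\<close> at \<open>1\<close>; for \<open>v = 1\<close> the two
  coincide.\<close>

lemma tau_plus_reciprocal:
  fixes v :: real
  assumes "v > 0"
  obtains y where "y > 0" "tau_plus (1 / v) = 1 / y" "y * exp (- y) = v * exp (- v)"
    "v \<le> 1 \<Longrightarrow> y \<ge> 1" "v > 1 \<Longrightarrow> y \<le> 1"
proof -
  define h where "h = - v * exp (- v)"
  have h: "- exp (-1) \<le> h" "h < 0"
    using w_exp_ge[of "- v"] assms by (auto simp: h_def)
  define w where "w = (if v \<le> 1 then Lambert_Wm1 h else Lambert_W0 h)"
  have w: "w * exp w = h" "v \<le> 1 \<Longrightarrow> w \<le> -1" "v > 1 \<Longrightarrow> w \<ge> -1"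
    using Lambert_W0_works[OF h] Lambert_Wm1_works[OF h] by (auto simp: w_def)
  have "w < 0"
    using w(1) h(2) by (smt (verit) exp_gt_zero mult_nonneg_nonneg)
  moreover have "tau_plus (1 / v) = 1 / (- w)"
    using assms by (auto simp: tau_plus_def w_def h_def le_divide_eq)
  ultimately show ?thesis
    using w by (intro that[of "- w"]) (auto simp: h_def)
qed

text \<open>The hypothesis amounts to \<open>y \<le> u\<close> for the partner \<open>y\<close> of
  \<open>v\<close>. Since \<open>a * exp (- a)\<close> rises up to \<open>1\<close> and falls
  afterwards, \<open>u\<close> is compared with whichever of \<open>v\<close> and \<open>y\<close>
  lies on its side of \<open>1\<close>.\<close>

lemma le_exp_transform:
  fixes u v :: real
  assumes "u > 0" "v > 0" "1 / u \<le> tau_plus (1 / v)"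
  shows "u = v \<Longrightarrow> u \<ge> 1"
    and "u > v \<Longrightarrow> u * exp (- u) \<le> v * exp (- v)"
    and "u < v \<Longrightarrow> v * exp (- v) \<le> u * exp (- u)"
proof -
  obtain y where y: "y > 0" "tau_plus (1 / v) = 1 / y" "y * exp (- y) = v * exp (- v)"
    "v \<le> 1 \<Longrightarrow> y \<ge> 1" "v > 1 \<Longrightarrow> y \<le> 1"
    using tau_plus_reciprocal[OF assms(2)] by blast
  have uy: "y \<le> u"
    using assms y by (simp add: field_simps)
  have dec: "b * exp (- b) \<le> a * exp (- a)" if "1 \<le> a" "a \<le> b" for a b :: real
    using w_exp_strict_antimono[of "- a" "- b"] that by (cases "a = b") auto
  have inc: "a * exp (- a) \<le> b * exp (- b)" if "b \<le> 1" "a \<le> b" for a b :: real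
    using w_exp_strict_mono[of "- b" "- a"] that by (cases "a = b") auto
  show "u \<ge> 1" if "u = v"
    using that y(4) uy by linarith
  show "u * exp (- u) \<le> v * exp (- v)" if "u > v"
    using dec[of y u] dec[of v u] that uy y by (cases "v \<le> 1") auto
  show "v * exp (- v) \<le> u * exp (- u)" if "u < v"
  proof (cases "u \<le> 1")
    case True
    then show ?thesis using inc[of u y] inc[of y u] uy y by auto
  next
    case False
    then show ?thesis using dec[of u v] that by auto
  qed
qed

subsection \<open>Hits and delayed misses along a sample path\<close>

text \<open>
  Request \<open>Suc n\<close> is the first request after request \<open>0\<close> that arrives when a fetch of duration \<open>d\<close>
  is over. The disjunct \<open>n = 0\<close> covers \<open>d = 0\<close>, the case of zero delay.
\<close>

definition first_after_fetch :: "real \<Rightarrow> nat \<Rightarrow> real \<Rightarrow> bool" where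
  "first_after_fetch x n d \<longleftrightarrow> d \<le> real (Suc n) * x \<and> (n = 0 \<or> real n * x < d)"

section \<open>States and request kinds within the first cycle\<close>

lemma request_kind_0: "request_kind x D T 0 = Fetch_Miss"
  by (simp add: request_kind_def)

lemma in_cycle_Suc:
  "Suc k \<in> cycle x D T \<longleftrightarrow> k \<in> cycle x D T \<and> request_kind x D T (Suc k) \<noteq> Fetch_Miss"
  by (auto simp: cycle_def atLeastAtMostSuc_conv)

lemma zero_in_cycle: "0 \<in> cycle x D T"
  by (simp add: cycle_def)

text \<open>While the cycle lasts no new fetch starts, so the fetch end stays \<open>D 0\<close>,
  and every request after it is a hit that renews the TTL. The disjunct \<open>k = 0\<close> covers
  \<open>D 0 = 0\<close>, where \<open>T 0\<close> is in force although
  \<open>real 0 * x < D 0\<close> fails.\<close>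

lemma cache_state_in_cycle:
  assumes "x > 0" "k \<in> cycle x D T"
  shows "cache_state x D T (Suc k) =
    (D 0, if k = 0 \<or> real k * x < D 0 then D 0 + T 0 else real k * x + T k)"
  using assms(2)
proof (induction k)
  case 0
  then show ?case by simp
next
  case (Suc k)
  have kc: "k \<in> cycle x D T" and nf: "request_kind x D T (Suc k) \<noteq> Fetch_Miss"
    using Suc.prems by (auto simp: in_cycle_Suc)
  note IH = Suc.IH[OF kc]
  have le: "real k * x \<le> real (Suc k) * x"
    using assms(1) by (intro mult_right_mono) auto
  show ?case
  proof (cases "real (Suc k) * x < D 0")
    case True
    then have "real k * x < D 0"
      using le by linarith
    then show ?thesis
      using True IH cache_state.simps(2)[of x D T "Suc k"] by (simp add: Let_def)
  next
    case False
    have "request_kind_at (real (Suc k) * x) (cache_state x D T (Suc k)) = Hit"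
      using nf False unfolding request_kind_def IH by (auto split: if_splits)
    then show ?thesis
      using False IH cache_state.simps(2)[of x D T "Suc k"] by (simp add: Let_def)
  qed
qed

lemma request_kind_in_cycle:
  assumes "x > 0" "k \<in> cycle x D T"
  shows "request_kind x D T (Suc k) =
    (if real (Suc k) * x < D 0 then Delayed_Miss
     else if real (Suc k) * x < (if k = 0 \<or> real k * x < D 0 then D 0 + T 0 else real k * x + T k)
       then Hit else Fetch_Miss)"
  unfolding request_kind_def cache_state_in_cycle[OF assms] by simp

lemma in_cycle_during_fetch:
  assumes "x > 0" "real k * x < D 0"
  shows "k \<in> cycle x D T"
  using assms(2)
proof (induction k)
  case 0
  then show ?case by (simp add: zero_in_cycle)
next
  case (Suc k)
  have "real k * x \<le> real (Suc k) * x"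
    using assms(1) by (intro mult_right_mono) auto
  then have "k \<in> cycle x D T"
    using Suc by linarith
  then show ?case
    using Suc.prems by (simp add: in_cycle_Suc request_kind_in_cycle[OF assms(1)])
qed

text \<open>Membership in the cycle is automatic while the fetch runs, so the delayed misses depend
  on \<open>D 0\<close> alone.\<close>

lemma cycle_delayed_miss_iff:
  assumes "x > 0"
  shows "Suc k \<in> cycle x D T \<and> request_kind x D T (Suc k) = Delayed_Miss \<longleftrightarrow>
    real (Suc k) * x < D 0"
  using in_cycle_during_fetch[OF assms, of "Suc k" D T]
  by (auto simp: in_cycle_Suc request_kind_in_cycle[OF assms] split: if_splits)

lemma first_after_fetch_unique:
  assumes "x > 0" "first_after_fetch x n d" "first_after_fetch x m d"
  shows "n = m"
proof -
  have "\<not> n < m" if "first_after_fetch x n d" "first_after_fetch x m d" for n m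
  proof
    assume "n < m"
    then have "real (Suc n) * x \<le> real m * x"
      using assms(1) by (intro mult_right_mono) auto
    then show False
      using that \<open>n < m\<close> by (auto simp: first_after_fetch_def)
  qed
  then show ?thesis
    using assms(2,3) by (meson linorder_neqE_nat)
qed

text \<open>The index \<open>n\<close> marks the interval in which the fetch ends. Request
  \<open>Suc n\<close> is a hit when the first TTL reaches beyond it; from there each request
  \<open>j\<close> up to \<open>k\<close> renews the TTL, and \<open>T j\<close> must outlast one
  gap \<open>x\<close>. For \<open>n = k\<close> this last condition is empty.\<close>

lemma cycle_hit_iff:
  assumes "x > 0"
  shows "Suc k \<in> cycle x D T \<and> request_kind x D T (Suc k) = Hit \<longleftrightarrow>
    (\<exists>n\<le>k. (first_after_fetch x n (D 0) \<and> real (Suc n) * x < D 0 + T 0) \<and>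
      (\<forall>j\<in>{Suc n..<Suc k}. x < T j))"
proof (induction k)
  case 0
  then show ?case
    using request_kind_in_cycle[OF assms zero_in_cycle]
    by (auto simp: in_cycle_Suc zero_in_cycle first_after_fetch_def)
next
  case (Suc k)
  show ?case
  proof (cases "real (Suc k) * x < D 0")
    case True
    \<comment> \<open>Request \<open>Suc k\<close> falls into the fetch, so only the new index
      \<open>n = Suc k\<close> can contribute.\<close>
    have "\<not> first_after_fetch x n (D 0)" if "n \<le> k" for n
    proof -
      have "real (Suc n) * x \<le> real (Suc k) * x"
        using that assms by (intro mult_right_mono) auto
      then show ?thesis
        using True by (auto simp: first_after_fetch_def)
    qed
    then have "(\<exists>n\<le>Suc k. (first_after_fetch x n (D 0) \<and> real (Suc n) * x < D 0 + T 0) \<and>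
        (\<forall>j\<in>{Suc n..<Suc (Suc k)}. x < T j)) \<longleftrightarrow>
        first_after_fetch x (Suc k) (D 0) \<and> real (Suc (Suc k)) * x < D 0 + T 0"
      by (auto simp: le_Suc_eq)
    then show ?thesis
      using True in_cycle_during_fetch[OF assms, of "Suc k" D T]
      by (auto simp: in_cycle_Suc[of "Suc k"] request_kind_in_cycle[OF assms] first_after_fetch_def
          split: if_splits)
  next
    case False
    then have nf: "\<not> first_after_fetch x (Suc k) (D 0)"
      by (auto simp: first_after_fetch_def)
    have "real (Suc k) * x \<le> real (Suc (Suc k)) * x"
      using assms by (intro mult_right_mono) auto
    then have F2: "\<not> real (Suc (Suc k)) * x < D 0"
      using False by linarith
    \<comment> \<open>Once the fetch is over, a later request of the cycle can only be a hit, so its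
      successor depends solely on \<open>T (Suc k)\<close>.\<close>
    have hit: "request_kind x D T (Suc k) = Hit" if "Suc k \<in> cycle x D T"
      using that False by (auto simp: in_cycle_Suc request_kind_in_cycle[OF assms] split: if_splits)
    have "real (Suc (Suc k)) * x < real (Suc k) * x + T (Suc k) \<longleftrightarrow> x < T (Suc k)"
      by (simp add: algebra_simps)
    then have "request_kind x D T (Suc (Suc k)) = (if x < T (Suc k) then Hit else Fetch_Miss)"
      if "Suc k \<in> cycle x D T"
      using False F2 by (simp only: request_kind_in_cycle[OF assms that] nat.distinct simp_thms if_False)
    then have "Suc (Suc k) \<in> cycle x D T \<and> request_kind x D T (Suc (Suc k)) = Hit \<longleftrightarrow>
        (Suc k \<in> cycle x D T \<and> request_kind x D T (Suc k) = Hit) \<and> x < T (Suc k)"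
      using hit in_cycle_Suc[of "Suc k" x D T] by (cases "x < T (Suc k)") auto
    also have "\<dots> \<longleftrightarrow> (\<exists>n\<le>Suc k. (first_after_fetch x n (D 0) \<and> real (Suc n) * x < D 0 + T 0) \<and>
        (\<forall>j\<in>{Suc n..<Suc (Suc k)}. x < T j))"
    proof -
      have *: "(\<forall>j\<in>{Suc n..<Suc (Suc k)}. x < T j) \<longleftrightarrow>
          (\<forall>j\<in>{Suc n..<Suc k}. x < T j) \<and> x < T (Suc k)" if "n \<le> k" for n
        using that atLeastLessThanSuc[of "Suc n" "Suc k"] by auto
      \<comment> \<open>Pure logic: the new index is excluded by \<open>nf\<close>, and each old one
        gains the condition \<open>X\<close>.\<close>
      have "(\<exists>n\<le>k. G n \<and> A n) \<and> X \<longleftrightarrow> (\<exists>n\<le>Suc k. G n \<and> B n)"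
        if "\<And>n. n \<le> k \<Longrightarrow> B n \<longleftrightarrow> A n \<and> X" "\<not> G (Suc k)" for A B G X
        using that by (metis le_Suc_eq)
      then show ?thesis
        unfolding Suc.IH by this (use * nf in simp_all)
    qed
    finally show ?thesis .
  qed
qed

subsection \<open>Expected numbers of hits and delayed misses\<close>

text \<open>The cardinality is a sum of indicators, and nonnegativity allows exchanging sum and
  integral. Index \<open>0\<close> contributes nothing, which is why the series runs over
  \<open>Suc k\<close>.\<close>

lemma nn_integral_emeasure_count_space_nat:
  fixes P :: "nat \<Rightarrow> 'a \<Rightarrow> bool"
  assumes meas: "\<And>k. {\<omega> \<in> space M. P (Suc k) \<omega>} \<in> sets M" and P0: "\<And>\<omega>. \<not> P 0 \<omega>"
  shows "(\<integral>\<^sup>+ \<omega>. emeasure (count_space UNIV) {k. P k \<omega>} \<partial>M) =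
    (\<Sum>k. emeasure M {\<omega> \<in> space M. P (Suc k) \<omega>})"
proof -
  have "emeasure (count_space UNIV) {k. P k \<omega>} =
      (\<Sum>k. indicator {\<omega> \<in> space M. P (Suc k) \<omega>} \<omega>)" if "\<omega> \<in> space M" for \<omega>
  proof -
    let ?f = "indicator {k. P k \<omega>} :: nat \<Rightarrow> ennreal"
    have "emeasure (count_space UNIV) {k. P k \<omega>} = (\<Sum>k. ?f k)"
      by (simp flip: nn_integral_indicator nn_integral_count_space_nat)
    also have "?f sums ((\<Sum>k. ?f (Suc k)) + ?f 0)"
      by (intro sums_Suc summable_sums summableI)
    then have "(\<Sum>k. ?f k) = (\<Sum>k. ?f (Suc k))"
      using P0 by (simp add: sums_unique[symmetric])
    finally show ?thesis
      using that by (simp add: indicator_def)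
  qed
  then have "(\<integral>\<^sup>+ \<omega>. emeasure (count_space UNIV) {k. P k \<omega>} \<partial>M) =
      (\<integral>\<^sup>+ \<omega>. (\<Sum>k. indicator {\<omega> \<in> space M. P (Suc k) \<omega>} \<omega>) \<partial>M)"
    by (rule nn_integral_cong)
  also have "\<dots> = (\<Sum>k. emeasure M {\<omega> \<in> space M. P (Suc k) \<omega>})"
    using meas by (subst nn_integral_suminf) auto
  finally show ?thesis .
qed

lemma nn_integral_cycle_hits:
  assumes "\<And>k. {\<omega> \<in> space M. Suc k \<in> cycle x (\<lambda>k. D k \<omega>) (\<lambda>k. T k \<omega>) \<and>
      request_kind x (\<lambda>k. D k \<omega>) (\<lambda>k. T k \<omega>) (Suc k) = Hit} \<in> sets M"
  shows "(\<integral>\<^sup>+ \<omega>. cycle_hits x (\<lambda>k. D k \<omega>) (\<lambda>k. T k \<omega>) \<partial>M) =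
    (\<Sum>k. emeasure M {\<omega> \<in> space M. Suc k \<in> cycle x (\<lambda>k. D k \<omega>) (\<lambda>k. T k \<omega>) \<and>
      request_kind x (\<lambda>k. D k \<omega>) (\<lambda>k. T k \<omega>) (Suc k) = Hit})"
  unfolding cycle_hits_def
  by (rule nn_integral_emeasure_count_space_nat) (use assms in \<open>simp_all add: request_kind_0\<close>)

lemma nn_integral_cycle_delayed_misses:
  assumes "x > 0" "D 0 \<in> borel_measurable M"
  shows "(\<integral>\<^sup>+ \<omega>. cycle_delayed_misses x (\<lambda>k. D k \<omega>) (\<lambda>k. T k \<omega>) \<partial>M) =
    (\<Sum>k. emeasure M {\<omega> \<in> space M. real (Suc k) * x < D 0 \<omega>})"
proof -
  note [measurable] = assms(2)
  have "(\<integral>\<^sup>+ \<omega>. cycle_delayed_misses x (\<lambda>k. D k \<omega>) (\<lambda>k. T k \<omega>) \<partial>M) =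
    (\<Sum>k. emeasure M {\<omega> \<in> space M. Suc k \<in> cycle x (\<lambda>k. D k \<omega>) (\<lambda>k. T k \<omega>) \<and>
      request_kind x (\<lambda>k. D k \<omega>) (\<lambda>k. T k \<omega>) (Suc k) = Delayed_Miss})"
    unfolding cycle_delayed_misses_def
  proof (rule nn_integral_emeasure_count_space_nat)
    show "{\<omega> \<in> space M. Suc k \<in> cycle x (\<lambda>k. D k \<omega>) (\<lambda>k. T k \<omega>) \<and>
      request_kind x (\<lambda>k. D k \<omega>) (\<lambda>k. T k \<omega>) (Suc k) = Delayed_Miss} \<in> sets M" for k
      unfolding cycle_delayed_miss_iff[OF assms(1)] by measurable
  qed (simp add: request_kind_0)
  then show ?thesis
    unfolding cycle_delayed_miss_iff[OF assms(1)] .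
qed

section \<open>Product formulas for independent families\<close>

lemma (in prob_space) prob_all_exponential_gt:
  fixes X :: "'i \<Rightarrow> 'a \<Rightarrow> real"
  assumes "indep_vars (\<lambda>_. borel) X I" "J \<subseteq> I" "finite J"
    and D: "\<And>j. j \<in> J \<Longrightarrow> distributed M lborel (X j) (exponential_density l)"
    and "0 < l" "0 \<le> x"
  shows "prob {\<omega> \<in> space M. \<forall>j\<in>J. x < X j \<omega>} = exp (- l * x) ^ card J"
\<comment> \<open>The empty intersection is \<open>UNIV\<close> rather than the sample space, so
  this case is separate.\<close>
proof (cases "J = {}")
  case True
  then show ?thesis by (simp add: prob_space)
next
  case False
  have "{\<omega> \<in> space M. \<forall>j\<in>J. x < X j \<omega>} = (\<Inter>j\<in>J. X j -` {x<..} \<inter> space M)"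
    using False by auto
  also have "prob \<dots> = (\<Prod>j\<in>J. prob (X j -` {x<..} \<inter> space M))"
    using assms False by (intro indep_varsD) auto
  also have "\<dots> = (\<Prod>j\<in>J. exp (- l * x))"
  proof (rule prod.cong[OF refl])
    fix j assume "j \<in> J"
    then have "prob {\<omega> \<in> space M. x < X j \<omega>} = exp (- x * l)"
      using exponential_distributedD_gt[OF D] assms by blast
    then show "prob (X j -` {x<..} \<inter> space M) = exp (- l * x)"
      by (simp add: vimage_def Int_def conj_commute mult.commute)
  qed
  finally show ?thesis by simp
qed

text \<open>Restrictions of the family to the disjoint index sets \<open>{a, b}\<close> and
  \<open>J\<close> are independent, and each event depends on one of them only. This separates the
  first hit from the later renewals.\<close>

lemma (in prob_space) prob_pair_and_tail:
  fixes X :: "'i \<Rightarrow> 'a \<Rightarrow> real"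
  assumes ind: "indep_vars (\<lambda>_. borel) X I"
    and sub: "a \<in> I" "b \<in> I" "J \<subseteq> I" "a \<notin> J" "b \<notin> J" "finite J"
    and R: "{z. R (fst z) (snd z)} \<in> sets (borel \<Otimes>\<^sub>M borel)"
  shows "prob {\<omega> \<in> space M. R (X a \<omega>) (X b \<omega>) \<and> (\<forall>j\<in>J. x < X j \<omega>)} =
    prob {\<omega> \<in> space M. R (X a \<omega>) (X b \<omega>)} * prob {\<omega> \<in> space M. \<forall>j\<in>J. x < X j \<omega>}"
proof -
  let ?P = "\<lambda>A. PiM A (\<lambda>_. borel :: real measure)"
  let ?r = "\<lambda>A \<omega>. restrict (\<lambda>i. X i \<omega>) A"
  have iv: "indep_var (?P {a, b}) (?r {a, b}) (?P J) (?r J)"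
    by (rule indep_var_restrict[OF ind]) (use sub in auto)
  have [measurable]: "Measurable.pred (borel \<Otimes>\<^sub>M borel) (\<lambda>z. R (fst z) (snd z))"
    using R by (simp add: pred_def space_pair_measure)
  have [measurable]: "(\<lambda>f. f a) \<in> borel_measurable (?P {a, b})" "(\<lambda>f. f b) \<in> borel_measurable (?P {a, b})"
    by (auto intro: measurable_component_singleton)
  have "Measurable.pred (?P {a, b}) (\<lambda>f. R (fst (f a, f b)) (snd (f a, f b)))"
    by measurable
  then have 1: "{f \<in> space (?P {a, b}). R (f a) (f b)} \<in> sets (?P {a, b})"
    by (simp add: pred_def)
  have 2: "{f \<in> space (?P J). \<forall>j\<in>J. x < f j} \<in> sets (?P J)"
    using sub(6) by measurable
  have r: "?r A \<omega> \<in> space (?P A)" for A \<omega>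
    by (auto simp: space_PiM)
  show ?thesis
    using indep_varD[OF iv 1 2] r
    by (simp add: vimage_def Int_def conj_commute cong: conj_cong)
qed

section \<open>Probability that the fetch ends in a given interval and a hit follows\<close>

text \<open>
  The integral of \<open>lD exp (- lD r) exp (- lT (x - r))\<close> over \<open>r\<close> from \<open>0\<close> to \<open>x\<close>: the fetch ends at
  time \<open>r\<close> within the first interval and the TTL outlives the rest of the interval.
\<close>

definition first_hit_weight :: "real \<Rightarrow> real \<Rightarrow> real \<Rightarrow> real" where
  "first_hit_weight lD lT x =
     (if lD = lT then lD * x * exp (- lT * x)
      else lD * (exp (- lT * x) - exp (- lD * x)) / (lD - lT))"

lemma nn_integral_first_hit:
  fixes lD lT x :: real
  assumes "lD > 0" "x > 0"
  shows "(\<integral>\<^sup>+ d. ennreal (lD * exp (- lD * d) * exp (- lT * (real (Suc n) * x - d))) *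
      indicator {real n * x..real (Suc n) * x} d \<partial>lborel) =
    ennreal (exp (- lD * x) ^ n * first_hit_weight lD lT x)"
proof -
  let ?f = "\<lambda>d. lD * exp (- lD * d) * exp (- lT * (real (Suc n) * x - d))"
  \<comment> \<open>An antiderivative of the integrand, which is constant in \<open>d\<close> when
    the rates agree.\<close>
  define F where "F = (\<lambda>d. if lD = lT then lD * exp (- lT * real (Suc n) * x) * d
    else - lD / (lD - lT) * exp ((lT - lD) * d - lT * real (Suc n) * x))"
  have f: "?f d = lD * exp ((lT - lD) * d - lT * real (Suc n) * x)" for d
    by (simp add: exp_add[symmetric] algebra_simps)
  have "(\<integral>\<^sup>+ d. ennreal (?f d) * indicator {real n * x..real (Suc n) * x} d \<partial>lborel) =
      ennreal (F (real (Suc n) * x) - F (real n * x))"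
  proof (rule nn_integral_FTC_Icc)
    show "DERIV F d :> ?f d" for d
    proof (cases "lD = lT")
      case True
      then show ?thesis
        unfolding f F_def by (auto intro!: derivative_eq_intros)
    next
      case False
      have "DERIV (\<lambda>d. - lD / (lD - lT) * exp ((lT - lD) * d - lT * real (Suc n) * x)) d :>
          - lD / (lD - lT) * ((lT - lD) * exp ((lT - lD) * d - lT * real (Suc n) * x))"
        by (intro DERIV_cmult) (auto intro!: derivative_eq_intros)
      also have "- lD / (lD - lT) * ((lT - lD) * e) = lD * e" for e
        using False by (simp add: field_simps)
      finally show ?thesis
        using False unfolding f F_def by simp
    qed
    show "real n * x \<le> real (Suc n) * x"
      using assms by (intro mult_right_mono) auto
  qed (use assms in auto)
  also have "F (real (Suc n) * x) - F (real n * x) = exp (- lD * x) ^ n * first_hit_weight lD lT x"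
  proof -
    have p: "exp (- lD * x) ^ n = exp (- lD * real n * x)"
      by (simp add: exp_of_nat_mult[symmetric] algebra_simps)
    show ?thesis
    proof (cases "lD = lT")
      case True
      then have "F (real (Suc n) * x) - F (real n * x) = lD * x * exp (- lT * real (Suc n) * x)"
        by (simp add: F_def algebra_simps)
      also have "exp (- lT * real (Suc n) * x) = exp (- lD * real n * x) * exp (- lT * x)"
        using True by (simp add: exp_add[symmetric] algebra_simps)
      finally show ?thesis
        using True p by (simp add: first_hit_weight_def)
    next
      case False
      have e1: "exp ((lT - lD) * (real (Suc n) * x) - lT * real (Suc n) * x) =
          exp (- lD * real n * x) * exp (- lD * x)"
        by (simp add: exp_add[symmetric] algebra_simps)
      have e2: "exp ((lT - lD) * (real n * x) - lT * real (Suc n) * x) =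
          exp (- lD * real n * x) * exp (- lT * x)"
        by (simp add: exp_add[symmetric] algebra_simps)
      have "F (real (Suc n) * x) - F (real n * x) =
          - lD / (lD - lT) * (exp (- lD * real n * x) * exp (- lD * x)) -
          - lD / (lD - lT) * (exp (- lD * real n * x) * exp (- lT * x))"
        unfolding F_def using False e1 e2 by simp
      also have "\<dots> = exp (- lD * real n * x) * first_hit_weight lD lT x"
        using False by (simp add: first_hit_weight_def diff_divide_distrib algebra_simps)
      finally show ?thesis
        using p by simp
    qed
  qed
  finally show ?thesis .
qed

text \<open>Integrating the product density over the TTL first leaves its tail at
  \<open>?b - d\<close>; what remains is the integral of
  \<open>nn_integral_first_hit\<close>.\<close>

lemma (in prob_space) emeasure_first_hit:
  fixes X Y :: "'a \<Rightarrow> real"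
  assumes ind: "indep_var lborel X lborel Y"
    and X: "distributed M lborel X (exponential_density lD)"
    and Y: "distributed M lborel Y (exponential_density lT)"
    and pos: "lD > 0" "lT > 0" "x > 0"
  shows "emeasure M {\<omega> \<in> space M. first_after_fetch x n (X \<omega>) \<and> real (Suc n) * x < X \<omega> + Y \<omega>} =
    ennreal (exp (- lD * x) ^ n * first_hit_weight lD lT x)"
proof -
  let ?b = "real (Suc n) * x"
  let ?gD = "exponential_density lD" and ?gT = "exponential_density lT"
  define A where "A = {z :: real \<times> real. first_after_fetch x n (fst z) \<and> ?b < fst z + snd z}"
  have A: "A \<in> sets (lborel \<Otimes>\<^sub>M lborel)"
  proof -
    have "{z \<in> space (borel \<Otimes>\<^sub>M borel). first_after_fetch x n (fst z) \<and> ?b < fst z + snd z}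
      \<in> sets (borel \<Otimes>\<^sub>M (borel :: real measure))"
      unfolding first_after_fetch_def by measurable
    then show ?thesis
      by (simp add: A_def space_pair_measure cong: sets_pair_measure_cong)
  qed
  note [measurable] = A
  have joint: "distributed M (lborel \<Otimes>\<^sub>M lborel) (\<lambda>\<omega>. (X \<omega>, Y \<omega>))
      (\<lambda>(d, t). ennreal (?gD d) * ennreal (?gT t))"
    using distributed_joint_indep[OF _ _ X Y ind] lborel.sigma_finite_measure_axioms by simp
  have tail: "(\<integral>\<^sup>+ t. ennreal (?gT t) * indicator {c<..} t \<partial>lborel) = ennreal (exp (- lT * c))"
    if "c \<ge> 0" for c
  proof -
    have "(\<integral>\<^sup>+ t. ennreal (?gT t) * indicator {c<..} t \<partial>lborel) = emeasure M (Y -` {c<..} \<inter> space M)"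
      by (rule distributed_emeasure[OF Y, symmetric]) simp
    also have "Y -` {c<..} \<inter> space M = {\<omega> \<in> space M. c < Y \<omega>}"
      by auto
    finally show ?thesis
      using exponential_distributedD_gt[OF Y that pos(2)]
      by (simp add: emeasure_eq_measure mult.commute)
  qed
  have "emeasure M {\<omega> \<in> space M. first_after_fetch x n (X \<omega>) \<and> ?b < X \<omega> + Y \<omega>} =
      emeasure M ((\<lambda>\<omega>. (X \<omega>, Y \<omega>)) -` A \<inter> space M)"
    by (rule arg_cong[where f = "emeasure M"]) (auto simp: A_def)
  also have "\<dots> = (\<integral>\<^sup>+ z. (case z of (d, t) \<Rightarrow> ennreal (?gD d) * ennreal (?gT t)) * indicator A z
      \<partial>(lborel \<Otimes>\<^sub>M lborel))"
    by (rule distributed_emeasure[OF joint A])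
  also have "\<dots> = (\<integral>\<^sup>+ d. \<integral>\<^sup>+ t. ennreal (?gD d) * ennreal (?gT t) * indicator A (d, t)
      \<partial>lborel \<partial>lborel)"
    by (subst lborel.nn_integral_fst[symmetric]) auto
  also have "\<dots> = (\<integral>\<^sup>+ d. ennreal (?gD d) * indicator {d. first_after_fetch x n d} d *
      (\<integral>\<^sup>+ t. ennreal (?gT t) * indicator {?b - d<..} t \<partial>lborel) \<partial>lborel)"
    by (subst nn_integral_cmult[symmetric])
      (auto intro!: nn_integral_cong simp: A_def indicator_def algebra_simps)
  also have "\<dots> = (\<integral>\<^sup>+ d. ennreal (lD * exp (- lD * d) * exp (- lT * (?b - d))) *
      indicator {real n * x..?b} d \<partial>lborel)"
  proof (rule nn_integral_cong_AE)
    \<comment> \<open>For \<open>n > 0\<close> the two ranges of \<open>d\<close> differ only at the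
      left endpoint, a null set. For \<open>n = 0\<close> the predicate also admits negative
      \<open>d\<close>, where the density vanishes.\<close>
    have "AE d in lborel. d \<noteq> real n * x"
      by (rule AE_lborel_singleton)
    then show "AE d in lborel. ennreal (?gD d) * indicator {d. first_after_fetch x n d} d *
        (\<integral>\<^sup>+ t. ennreal (?gT t) * indicator {?b - d<..} t \<partial>lborel) =
      ennreal (lD * exp (- lD * d) * exp (- lT * (?b - d))) * indicator {real n * x..?b} d"
    proof eventually_elim
      case (elim d)
      show ?case
      proof (cases "d \<in> {real n * x..?b}")
        case True
        have "0 \<le> real n * x"
          using pos by simp
        then have "0 \<le> d"
          using True by (meson atLeastAtMost_iff order_trans)
        moreover have "first_after_fetch x n d"
          using True elim by (auto simp: first_after_fetch_def)
        ultimately show ?thesis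
          using True pos tail[of "?b - d"]
          by (simp add: exponential_density_def ennreal_mult[symmetric] mult.commute)
      next
        case False
        then have "d < 0 \<or> \<not> first_after_fetch x n d"
          by (cases "n = 0") (auto simp: first_after_fetch_def)
        then show ?thesis
          using False by (auto simp: exponential_density_def)
      qed
    qed
  qed
  also have "\<dots> = ennreal (exp (- lD * x) ^ n * first_hit_weight lD lT x)"
    by (rule nn_integral_first_hit[OF pos(1,3)])
  finally show ?thesis .
qed

subsection \<open>Comparison of the hit probabilities\<close>

text \<open>Multiplying by \<open>lD - lT\<close> turns the claim into a comparison of
  \<open>lD * exp (- lD * x)\<close> with \<open>lT * exp (- lT * x)\<close>, reversed when
  \<open>lD < lT\<close>. For equal rates the weight is \<open>lD * x\<close> times the left-hand
  side, so \<open>lD * x \<ge> 1\<close> is what is needed.\<close>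

lemma first_hit_weight_ge:
  assumes pos: "lD > 0" "lT > 0" "x > 0"
    and le: "1 / (lD * x) \<le> tau_plus (1 / (lT * x))"
  shows "exp (- lT * x) \<le> first_hit_weight lD lT x"
proof -
  have uv: "lD * x > 0" "lT * x > 0"
    using pos by auto
  note L = le_exp_transform[OF uv le]
  consider "lD = lT" | "lD > lT" | "lD < lT"
    by linarith
  then show ?thesis
  proof cases
    case 1
    then show ?thesis
      using L(1) by (simp add: first_hit_weight_def)
  next
    case 2
    then have "(lD * exp (- (lD * x))) * x \<le> (lT * exp (- (lT * x))) * x"
      using L(2) pos by (simp add: mult.commute mult.left_commute)
    then have "lD * exp (- (lD * x)) \<le> lT * exp (- (lT * x))"
      using pos by simp
    then show ?thesis
      using 2 by (simp add: first_hit_weight_def pos_le_divide_eq algebra_simps)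
  next
    case 3
    then have "(lT * exp (- (lT * x))) * x \<le> (lD * exp (- (lD * x))) * x"
      using L(3) pos by (simp add: mult.commute mult.left_commute)
    then have "lT * exp (- (lT * x)) \<le> lD * exp (- (lD * x))"
      using pos by simp
    then show ?thesis
      using 3 by (simp add: first_hit_weight_def neg_le_divide_eq algebra_simps)
  qed
qed

section \<open>Hit probabilities in closed form\<close>

lemma suminf_ennreal_power_Suc:
  assumes "0 \<le> r" "r < 1"
  shows "(\<Sum>k. ennreal (r ^ Suc k)) = ennreal (r / (1 - r))"
  using sums_mult[OF geometric_sums[of r], of r] assms by (intro suminf_ennreal_eq) auto

lemma hit_probability_eq:
  assumes "(\<integral>\<^sup>+ \<omega>. cycle_hits x (\<lambda>k. D k \<omega>) (\<lambda>k. T k \<omega>) \<partial>M) = ennreal n"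
    and "(\<integral>\<^sup>+ \<omega>. cycle_delayed_misses x (\<lambda>k. D k \<omega>) (\<lambda>k. T k \<omega>) \<partial>M) = ennreal m"
    and "n \<ge> 0" "m \<ge> 0"
  shows "hit_probability M x D T = ennreal (n / (1 + m + n))"
proof -
  have "1 + ennreal m + ennreal n = ennreal (1 + m + n)"
    using assms(3,4) by (simp add: ennreal_plus flip: ennreal_1)
  then show ?thesis
    using assms by (simp add: hit_probability_def Let_def divide_ennreal del: ennreal_plus)
qed

text \<open>The number of hits is geometric: request \<open>Suc k\<close> is a hit when all of
  \<open>T 0\<close>, ..., \<open>T k\<close> exceed \<open>x\<close>. There are no delayed
  misses.\<close>

lemma (in prob_space) hit_probability_zero_delay:
  fixes D T :: "nat \<Rightarrow> 'a \<Rightarrow> real"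
  assumes ind: "indep_vars (\<lambda>_. borel) (case_sum D T) UNIV"
    and T: "\<And>k. distributed M lborel (T k) (exponential_density lT)"
    and pos: "lT > 0" "x > 0"
  shows "hit_probability M x (\<lambda>_ _. 0) T = ennreal (exp (- lT * x))"
proof -
  define q where "q = exp (- lT * x)"
  have q: "0 < q" "q < 1"
    using pos by (auto simp: q_def)
  have [measurable]: "T k \<in> borel_measurable M" for k
    using distributed_measurable[OF T] by simp
  have hit: "Suc k \<in> cycle x (\<lambda>k. 0) (\<lambda>k. T k \<omega>) \<and>
      request_kind x (\<lambda>k. 0) (\<lambda>k. T k \<omega>) (Suc k) = Hit \<longleftrightarrow> (\<forall>j\<in>{..k}. x < T j \<omega>)" for k \<omega>
  proof -
    have "first_after_fetch x n 0 \<longleftrightarrow> n = 0" for n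
      using pos by (auto simp: first_after_fetch_def zero_le_mult_iff mult_less_0_iff)
    moreover have "{..k} = insert 0 {Suc 0..<Suc k}"
      by auto
    ultimately show ?thesis
      unfolding cycle_hit_iff[OF pos(2)] by auto
  qed
  have P: "emeasure M {\<omega> \<in> space M. \<forall>j\<in>{..k}. x < T j \<omega>} = ennreal (q ^ Suc k)" for k
  proof -
    have "prob {\<omega> \<in> space M. \<forall>j\<in>Inr ` {..k}. x < case_sum D T j \<omega>} = q ^ card (Inr ` {..k} :: (nat + nat) set)"
      unfolding q_def
      by (rule prob_all_exponential_gt[OF ind]) (use T pos in auto)
    then show ?thesis
      by (simp add: emeasure_eq_measure card_image)
  qed
  have "(\<integral>\<^sup>+ \<omega>. cycle_hits x (\<lambda>k. 0) (\<lambda>k. T k \<omega>) \<partial>M) = (\<Sum>k. ennreal (q ^ Suc k))"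
    by (subst nn_integral_cycle_hits[where D = "\<lambda>_ _. 0"], unfold hit P) simp_all
  also have "\<dots> = ennreal (q / (1 - q))"
    using q by (intro suminf_ennreal_power_Suc) auto
  finally have EN: "(\<integral>\<^sup>+ \<omega>. cycle_hits x (\<lambda>k. 0) (\<lambda>k. T k \<omega>) \<partial>M) = ennreal (q / (1 - q))" .
  have Em: "(\<integral>\<^sup>+ \<omega>. cycle_delayed_misses x (\<lambda>k. 0) (\<lambda>k. T k \<omega>) \<partial>M) = ennreal 0"
    using nn_integral_cycle_delayed_misses[OF pos(2), of "\<lambda>_ _. 0" M T] pos
    by (simp add: mult_less_0_iff)
  have "hit_probability M x (\<lambda>_ _. 0) T = ennreal (q / (1 - q) / (1 + 0 + q / (1 - q)))"
    by (rule hit_probability_eq) (use EN Em q in auto)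
  also have "q / (1 - q) / (1 + 0 + q / (1 - q)) = q"
    using q by (simp add: field_simps)
  finally show ?thesis
    by (simp add: q_def)
qed

text \<open>The hit event of request \<open>Suc k\<close> is split by the interval \<open>n\<close>
  in which the fetch ends. Hypothesis \<open>J\<close> keeps the real-valued terms nonnegative under
  \<open>ennreal\<close>.\<close>

lemma (in prob_space) hit_probability_exponential_delay:
  fixes D T :: "nat \<Rightarrow> 'a \<Rightarrow> real"
  assumes ind: "indep_vars (\<lambda>_. borel) (case_sum D T) UNIV"
    and T: "\<And>k. distributed M lborel (T k) (exponential_density lT)"
    and D: "\<And>k. distributed M lborel (D k) (exponential_density lD)"
    and pos: "lD > 0" "lT > 0" "x > 0"
    and J: "first_hit_weight lD lT x \<ge> 0"
  shows "hit_probability M x D T =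
    ennreal (first_hit_weight lD lT x / (1 - exp (- lT * x) + first_hit_weight lD lT x))"
proof -
  define q where "q = exp (- lT * x)"
  define p where "p = exp (- lD * x)"
  define w where "w = first_hit_weight lD lT x"
  have q: "0 < q" "q < 1" and p: "0 < p" "p < 1" and w: "0 \<le> w"
    using pos J by (auto simp: q_def p_def w_def)
  have [measurable]: "T k \<in> borel_measurable M" "D k \<in> borel_measurable M" for k
    using distributed_measurable[OF T] distributed_measurable[OF D] by simp_all
  define B where "B n = (\<lambda>d t. first_after_fetch x n d \<and> real (Suc n) * x < d + t)" for n
  define E where "E k n = {\<omega> \<in> space M. B n (D 0 \<omega>) (T 0 \<omega>) \<and> (\<forall>j\<in>{Suc n..<Suc k}. x < T j \<omega>)}"
    for k n
  have hit: "{\<omega> \<in> space M. Suc k \<in> cycle x (\<lambda>k. D k \<omega>) (\<lambda>k. T k \<omega>) \<and>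
      request_kind x (\<lambda>k. D k \<omega>) (\<lambda>k. T k \<omega>) (Suc k) = Hit} = (\<Union>n\<in>{..k}. E k n)" for k
    unfolding cycle_hit_iff[OF pos(3)] E_def B_def by auto
  have E_sets [measurable]: "E k n \<in> sets M" for k n
    unfolding E_def B_def first_after_fetch_def by measurable
  \<comment> \<open>Independence of \<open>D 0\<close> and \<open>T 0\<close> is read off from the
    singleton blocks of the joint family.\<close>
  have "indep_var lborel ((\<lambda>f. f (Inl 0)) \<circ> (\<lambda>\<omega>. \<lambda>i\<in>{Inl 0}. case_sum D T i \<omega>))
      lborel ((\<lambda>f. f (Inr 0)) \<circ> (\<lambda>\<omega>. \<lambda>i\<in>{Inr 0}. case_sum D T i \<omega>))"
    by (intro indep_var_compose[OF indep_var_restrict[OF ind]]) auto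
  then have ind0: "indep_var lborel (D 0) lborel (T 0)"
    by (simp add: comp_def)
  have PB: "prob {\<omega> \<in> space M. B n (D 0 \<omega>) (T 0 \<omega>)} = p ^ n * w" for n
    using emeasure_first_hit[OF ind0 D T pos, of n] w p
    by (simp add: B_def emeasure_eq_measure p_def w_def)
  have PE: "prob (E k n) = (p ^ n * w) * q ^ (k - n)" for k n
  proof -
    let ?J = "Inr ` {Suc n..<Suc k} :: (nat + nat) set"
    have "{z. B n (fst z) (snd z)} \<in> sets (borel \<Otimes>\<^sub>M borel)"
    proof -
      have "{z \<in> space (borel \<Otimes>\<^sub>M borel). B n (fst z) (snd z)} \<in> sets (borel \<Otimes>\<^sub>M borel)"
        unfolding B_def first_after_fetch_def by measurable
      then show ?thesis
        by (simp add: space_pair_measure)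
    qed
    moreover have "Inl 0 \<notin> ?J" "Inr 0 \<notin> ?J"
      by auto
    ultimately have "prob (E k n) = prob {\<omega> \<in> space M. B n (D 0 \<omega>) (T 0 \<omega>)} *
        prob {\<omega> \<in> space M. \<forall>j\<in>?J. x < case_sum D T j \<omega>}"
      using prob_pair_and_tail[OF ind, of "Inl 0" "Inr 0" ?J "B n" x] by (simp add: E_def)
    also have "prob {\<omega> \<in> space M. \<forall>j\<in>?J. x < case_sum D T j \<omega>} = q ^ card ?J"
      unfolding q_def by (rule prob_all_exponential_gt[OF ind]) (use T pos in auto)
    finally show ?thesis
      using PB by (simp add: card_image)
  qed
  \<comment> \<open>The fetch ends in one interval only, so the probabilities add up.\<close>
  have disj: "disjoint_family_on (E k) {..k}" for k
    using first_after_fetch_unique[OF pos(3)] by (auto simp: disjoint_family_on_def E_def B_def)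
  have PU: "emeasure M (\<Union>n\<in>{..k}. E k n) = ennreal (\<Sum>n\<le>k. (p ^ n * w) * q ^ (k - n))" for k
    using finite_measure_finite_Union[OF _ _ disj, of k] PE
    by (simp add: emeasure_eq_measure image_subset_iff)
  \<comment> \<open>The expected number of hits is a Cauchy product: \<open>n\<close> is the position of the first hit and
    \<open>k - n\<close> the number of renewals after it.\<close>
  have "(\<lambda>k. \<Sum>n\<le>k. (p ^ n * w) * q ^ (k - n)) sums ((\<Sum>k. p ^ k * w) * (\<Sum>k. q ^ k))"
    using p q w by (intro Cauchy_product_sums) (auto simp: abs_mult power_abs intro!: summable_mult2 summable_geometric)
  also have "(\<Sum>k. p ^ k * w) * (\<Sum>k. q ^ k) = w / ((1 - p) * (1 - q))"
    using p q by (simp add: suminf_mult2[symmetric] suminf_geometric)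
  finally have sums: "(\<lambda>k. \<Sum>n\<le>k. (p ^ n * w) * q ^ (k - n)) sums (w / ((1 - p) * (1 - q)))" .
  have "(\<integral>\<^sup>+ \<omega>. cycle_hits x (\<lambda>k. D k \<omega>) (\<lambda>k. T k \<omega>) \<partial>M) =
      (\<Sum>k. ennreal (\<Sum>n\<le>k. (p ^ n * w) * q ^ (k - n)))"
    by (subst nn_integral_cycle_hits, unfold hit PU) auto
  also have "\<dots> = ennreal (w / ((1 - p) * (1 - q)))"
    using p q w by (intro suminf_ennreal_eq[OF _ sums] sum_nonneg) auto
  finally have EN: "(\<integral>\<^sup>+ \<omega>. cycle_hits x (\<lambda>k. D k \<omega>) (\<lambda>k. T k \<omega>) \<partial>M) =
      ennreal (w / ((1 - p) * (1 - q)))" .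
  have PD: "emeasure M {\<omega> \<in> space M. real (Suc k) * x < D 0 \<omega>} = ennreal (p ^ Suc k)" for k
  proof -
    have "prob {\<omega> \<in> space M. real (Suc k) * x < D 0 \<omega>} = exp (- (real (Suc k) * x) * lD)"
      using pos by (intro exponential_distributedD_gt[OF D]) auto
    also have "\<dots> = exp (real (Suc k) * (- lD * x))"
      by (simp add: algebra_simps)
    also have "\<dots> = p ^ Suc k"
      unfolding p_def by (rule exp_of_nat_mult)
    finally show ?thesis
      by (simp only: emeasure_eq_measure)
  qed
  have "(\<integral>\<^sup>+ \<omega>. cycle_delayed_misses x (\<lambda>k. D k \<omega>) (\<lambda>k. T k \<omega>) \<partial>M) =
      (\<Sum>k. ennreal (p ^ Suc k))"
    unfolding PD[symmetric] by (rule nn_integral_cycle_delayed_misses[OF pos(3)]) measurable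
  also have "\<dots> = ennreal (p / (1 - p))"
    using p by (intro suminf_ennreal_power_Suc) auto
  finally have Em: "(\<integral>\<^sup>+ \<omega>. cycle_delayed_misses x (\<lambda>k. D k \<omega>) (\<lambda>k. T k \<omega>) \<partial>M) =
      ennreal (p / (1 - p))" .
  have "hit_probability M x D T = ennreal (w / ((1 - p) * (1 - q)) /
      (1 + p / (1 - p) + w / ((1 - p) * (1 - q))))"
    using p q w by (intro hit_probability_eq[OF EN Em]) simp_all
  \<comment> \<open>This is \<open>1 / (1 - p)\<close>, expanded by \<open>1 - q\<close> to share
    the denominator of \<open>E[N]\<close>, which then cancels.\<close>
  also have "1 + p / (1 - p) = (1 - q) / ((1 - p) * (1 - q))"
    using p q by (simp add: divide_simps)
  also have "(1 - q) / ((1 - p) * (1 - q)) + w / ((1 - p) * (1 - q)) = (1 - q + w) / ((1 - p) * (1 - q))"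
    by (rule add_divide_distrib[symmetric])
  also have "w / ((1 - p) * (1 - q)) / \<dots> = w / (1 - q + w)"
    using p q by simp
  finally show ?thesis
    by (simp add: q_def w_def)
qed

theorem mainTheorem6:
  fixes M :: "'a measure"
    and D T :: "nat \<Rightarrow> 'a \<Rightarrow> real"
    and x lambda_D lambda_T tau_D tau_T :: real
  assumes "prob_space M"
    and "x > 0" and "lambda_T > 0" and "lambda_D > 0"
    and "\<And>k. distributed M lborel (T k) (exponential_density lambda_T)"
    and "\<And>k. distributed M lborel (D k) (exponential_density lambda_D)"
    and "prob_space.indep_vars M (\<lambda>_. borel) (case_sum D T) (UNIV :: (nat + nat) set)"
    and "tau_D = 1 / (lambda_D * x)" and "tau_T = 1 / (lambda_T * x)"
    and "tau_D \<le> tau_plus tau_T"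
  shows "hit_probability M x D T \<ge> hit_probability M x (\<lambda>_ _. 0) T"
proof -
  interpret prob_space M by fact
  define q where "q = exp (- lambda_T * x)"
  define w where "w = first_hit_weight lambda_D lambda_T x"
  have q: "0 < q" "q < 1"
    using assms(2,3) by (auto simp: q_def)
  have "q \<le> w"
    unfolding q_def w_def using assms(2-4,8-10) by (intro first_hit_weight_ge) auto
  \<comment> \<open>Adding \<open>q * w\<close> to both sides gives
    \<open>q * (1 - q + w) \<le> w\<close>, the desired bound with its denominator cleared.\<close>
  then have "q * (1 - q) \<le> w * (1 - q)"
    using q by (intro mult_right_mono) auto
  then have "q \<le> w / (1 - q + w)"
    using q \<open>q \<le> w\<close> by (simp add: pos_le_divide_eq algebra_simps)
  moreover have "hit_probability M x (\<lambda>_ _. 0) T = ennreal q"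
    unfolding q_def by (rule hit_probability_zero_delay[OF assms(7,5,3,2)])
  moreover have "hit_probability M x D T = ennreal (w / (1 - q + w))"
    unfolding q_def w_def
    by (rule hit_probability_exponential_delay[OF assms(7,5,6,4,3,2)])
      (use \<open>q \<le> w\<close> q in \<open>auto simp: w_def\<close>)
  ultimately show ?thesis
    by (simp add: ennreal_leI)
qed

end
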